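(* Let $n>1$ be an integer and let $f\in\mathcal{R}$ be an eigenfunction of $U_n$ with eigenvalue $\lambda\neq 0$ (that is, $f\neq 0$ and $U_n f=\lambda f$). Then all of the poles of $f$ are roots of unity.
   Context: $\mathcal{R}$ is the complex vector space of rational functions $p(x)/q(x)$, $p,q\in\mathbb{C}[x]$, that are analytic at the origin; each is identified with its Taylor series $\sum_{k\ge 0}a(k)x^k$ at $0$. For a positive integer $n$, the operator $U_n:\mathcal{R}\to\mathcal{R}$ is the linear operator $U_n\left(\sum_{k\ge 0}a(k)x^k\right)=\sum_{k\ge 0}a(nk)x^k$ (it is known that $U_n$ maps $\mathcal{R}$ to $\mathcal{R}$). Poles are poles in $\mathbb{C}$. *)

theory Defs
  imports
    "HOL-Complex_Analysis.Complex_Analysis"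
    "HOL-Computational_Algebra.Computational_Algebra"
    "HOL-Computational_Algebra.Field_as_Ring"
begin

text \<open>
  A rational function is an element of the fraction field of the complex polynomials. As a function
  on the complex numbers it is evaluated through its reduced representation, so that common factors
  of numerator and denominator do not produce spurious singularities. At a zero of the reduced
  denominator the value is 0 by the convention for division by zero; the function is then not
  continuous there, hence not analytic.
\<close>

definition rat_eval :: "complex poly fract \<Rightarrow> complex \<Rightarrow> complex" where
  "rat_eval f z = poly (fst (quot_of_fract f)) z / poly (snd (quot_of_fract f)) z"

definition rat_analytic_0 :: "complex poly fract set" where
  "rat_analytic_0 = {f. rat_eval f analytic_on {0}}"

definition taylor_0 :: "complex poly fract \<Rightarrow> complex fps" where
  "taylor_0 f = fps_expansion (rat_eval f) 0"

text \<open>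
  The operator is given by its formula on all formal power series; elements of
  \<^const>\<open>rat_analytic_0\<close> enter through their Taylor series at the origin.
\<close>

definition U_op :: "nat \<Rightarrow> complex fps \<Rightarrow> complex fps" where
  "U_op n F = Abs_fps (\<lambda>k. fps_nth F (n * k))"

lemma rat_eval_Fract:
  assumes "poly q z \<noteq> 0"
  shows "rat_eval (Fraction_Field.Fract p q) z = poly p z / poly q z"
proof -
  define a b where "a = fst (quot_of_fract (Fraction_Field.Fract p q))" and "b = snd (quot_of_fract (Fraction_Field.Fract p q))"
  have q: "q \<noteq> 0" using assms by auto
  have b: "b \<noteq> 0" by (simp add: b_def)
  have "Fraction_Field.Fract a b = Fraction_Field.Fract p q"
    unfolding a_def b_def using quot_to_fract_quot_of_fract[of "Fraction_Field.Fract p q"]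
    by (simp add: quot_to_fract_def case_prod_unfold)
  then have eq: "a * q = p * b" using q b by (simp add: eq_fract)
  have cop: "coprime a b"
    unfolding a_def b_def by (rule coprime_quot_of_fract)
  have "b dvd a * q" using eq by simp
  then have "b dvd q" using cop
    by (simp add: coprime_commute coprime_dvd_mult_right_iff)
  then have bz: "poly b z \<noteq> 0" using assms by (auto elim!: dvdE)
  have "poly a z * poly q z = poly p z * poly b z"
    using arg_cong[OF eq, of "\<lambda>r. poly r z"] by simp
  then show ?thesis
    unfolding rat_eval_def a_def[symmetric] b_def[symmetric]
    using bz assms by (simp add: frac_eq_eq)
qed

end

theory Submission
  imports Defs
begin

text \<open>
  Write \<open>f = a / b\<close> in lowest terms and let \<open>S\<close> be the finite set of roots of \<open>b\<close>, which contains
  every pole of \<open>f\<close>. The poles of \<open>U\<^sub>n f\<close> are \<open>n\<close>-th powers of poles of \<open>f\<close>. Indeed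
  \<open>x - w\<close> divides \<open>x\<^sup>n - w\<^sup>n\<close>, so \<open>b(x)\<close> divides \<open>Q(x\<^sup>n)\<close> for the polynomial \<open>Q\<close> whose roots are the
  \<open>n\<close>-th powers of those of \<open>b\<close>
  (lemma \<open>dvd_pcompose_monom_power_roots\<close>), and \<open>f\<close> can be rewritten as \<open>r(x) / Q(x\<^sup>n)\<close> with a
  polynomial \<open>r\<close>. Since \<open>U\<^sub>n\<close> is linear over power series in \<open>x\<^sup>n\<close>
  (lemma \<open>U_op_mult_pcompose_monom\<close>), this gives \<open>U\<^sub>n f = U\<^sub>n r / Q\<close>, where \<open>U\<^sub>n r\<close> is a polynomial.

  For an eigenfunction with \<open>\<mu> \<noteq> 0\<close> it follows that \<open>f\<close> itself is a polynomial divided by \<open>Q\<close>, so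
  \<open>b\<close> divides \<open>Q\<close> and each element of \<open>S\<close> is the \<open>n\<close>-th power of an element of \<open>S\<close>. As \<open>S\<close> is
  finite, the map \<open>w \<mapsto> w\<^sup>n\<close> then permutes \<open>S\<close>. The iterates \<open>w\<close>, \<open>w\<^sup>n\<close>, \<dots> of any
  \<open>w \<in> S\<close> therefore stay in a finite set, two of them coincide, and \<open>w\<close>, being nonzero, is a root
  of unity.
\<close>

section \<open>The operator on products and polynomials\<close>

lemma U_op_add: "U_op n (F + G) = U_op n F + U_op n G"
  by (simp add: U_op_def fps_eq_iff)

lemma U_op_const_mult: "U_op n (fps_const c * F) = fps_const c * U_op n F"
  by (simp add: U_op_def fps_eq_iff)

lemma U_op_X_power_mult:
  assumes "n > 0"
  shows "U_op n (fps_X ^ n * F) = fps_X * U_op n F"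
proof (rule fps_ext)
  fix k
  show "fps_nth (U_op n (fps_X ^ n * F)) k = fps_nth (fps_X * U_op n F) k"
    using assms by (cases k) (simp_all add: U_op_def fps_X_power_mult_nth)
qed

text \<open>
  The factor \<open>x\<^sup>n\<close> shifts the coefficients by \<open>n\<close> places, which becomes a shift by one place after
  sampling every \<open>n\<close>-th coefficient; by linearity the same exchange of \<open>x\<^sup>n\<close> for \<open>x\<close> holds for any
  polynomial in \<open>x\<^sup>n\<close>.
\<close>

lemma U_op_mult_pcompose_monom:
  assumes "n > 0"
  shows "U_op n (F * fps_of_poly (pcompose Q (monom 1 n))) = U_op n F * fps_of_poly Q"
proof (induction Q)
  case 0
  show ?case by (simp add: U_op_def fps_eq_iff)
next
  case (pCons c Q)
  define G where "G = fps_of_poly (pcompose Q (monom 1 n))"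
  have "F * fps_of_poly (pcompose (pCons c Q) (monom 1 n))
      = fps_const c * F + fps_X ^ n * (F * G)"
    by (simp add: pcompose_pCons fps_of_poly_add fps_of_poly_mult fps_of_poly_monom fps_of_poly_const
        G_def algebra_simps)
  then have "U_op n (F * fps_of_poly (pcompose (pCons c Q) (monom 1 n)))
      = fps_const c * U_op n F + fps_X * (U_op n F * fps_of_poly Q)"
    using pCons.IH assms
    by (simp add: U_op_add U_op_const_mult U_op_X_power_mult G_def)
  then show ?case
    by (simp add: fps_of_poly_pCons algebra_simps)
qed

lemma U_op_fps_of_poly:
  assumes "n > 0"
  obtains s where "U_op n (fps_of_poly r) = fps_of_poly s"
proof
  define s where "s = Poly (map (\<lambda>k. coeff r (n * k)) [0..<Suc (degree r)])"
  have "coeff s k = coeff r (n * k)" for k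
  proof (cases "k < Suc (degree r)")
    case True
    then show ?thesis by (simp add: s_def coeff_Poly_eq nth_default_def del: upt_Suc)
  next
    case False
    moreover have "k \<le> n * k" using assms by simp
    ultimately have "degree r < n * k" by linarith
    then show ?thesis using False
      by (simp add: s_def coeff_Poly_eq nth_default_def coeff_eq_0 del: upt_Suc)
  qed
  then show "U_op n (fps_of_poly r) = fps_of_poly s"
    by (simp add: U_op_def fps_eq_iff)
qed

section \<open>Powers of roots\<close>

text \<open>
  The witness is the product of \<open>x - w\<^sup>n\<close> over the roots \<open>w\<close> of \<open>q\<close> with multiplicity, since
  \<open>x - w\<close> divides \<open>x\<^sup>n - w\<^sup>n\<close>. The induction splits off one linear factor at a time.
\<close>

lemma dvd_pcompose_monom_power_roots:
  fixes q :: "complex poly"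
  assumes "q \<noteq> 0"
  obtains Q where "q dvd pcompose Q (monom 1 n)"
    and "\<And>z. poly Q z = 0 \<Longrightarrow> \<exists>w. poly q w = 0 \<and> z = w ^ n"
proof -
  have "\<exists>Q. q dvd pcompose Q (monom 1 n) \<and> (\<forall>z. poly Q z = 0 \<longrightarrow> (\<exists>w. poly q w = 0 \<and> z = w ^ n))"
    using assms
  proof (induction "degree q" arbitrary: q)
    case 0
    then have "is_unit q" by (simp add: is_unit_iff_degree)
    then show ?case by (intro exI[of _ 1]) (simp add: pcompose_1)
  next
    case (Suc d)
    then have "\<not> constant (poly q)" by (simp add: constant_degree)
    then obtain w where w: "poly q w = 0"
      using fundamental_theorem_of_algebra by blast
    then obtain q' where q': "q = [:-w, 1:] * q'"
      by (auto simp: poly_eq_0_iff_dvd)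
    with Suc.prems have "q' \<noteq> 0" by auto
    moreover from this have "degree q = Suc (degree q')"
      unfolding q' by (subst degree_mult_eq) auto
    ultimately obtain Q' where dvd: "q' dvd pcompose Q' (monom 1 n)"
      and roots: "\<forall>z. poly Q' z = 0 \<longrightarrow> (\<exists>v. poly q' v = 0 \<and> z = v ^ n)"
      using Suc.hyps by (metis Suc_inject)
    have "[:-w, 1:] dvd pcompose [:-(w ^ n), 1:] (monom 1 n)"
      by (simp add: poly_eq_0_iff_dvd[symmetric] poly_pcompose poly_monom)
    with dvd have "q dvd pcompose ([:-(w ^ n), 1:] * Q') (monom 1 n)"
      unfolding q' pcompose_mult by (rule mult_dvd_mono[rotated])
    moreover have "\<exists>v. poly q v = 0 \<and> z = v ^ n" if "poly ([:-(w ^ n), 1:] * Q') z = 0" for z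
      using that roots w by (auto simp: q')
    ultimately show ?case by blast
  qed
  then show ?thesis using that by blast
qed

text \<open>
  A finite set covered by its own image is mapped onto itself, so the orbit of \<open>w\<close> under
  taking \<open>n\<close>-th powers lies in it and repeats; cancelling the smaller power leaves \<open>w\<^sup>m = 1\<close>.
\<close>

lemma root_of_unity_if_subset_powers:
  fixes S :: "complex set"
  assumes "finite S" and "0 \<notin> S" and "n > 1" and sub: "S \<subseteq> (\<lambda>w. w ^ n) ` S" and "w \<in> S"
  shows "\<exists>m>0. w ^ m = 1"
proof -
  have "card ((\<lambda>w. w ^ n) ` S) \<le> card S"
    using \<open>finite S\<close> by (rule card_image_le)
  with sub \<open>finite S\<close> have image: "S = (\<lambda>w. w ^ n) ` S"
    by (intro card_seteq) auto
  have orbit: "w ^ (n ^ i) \<in> S" for i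
  proof (induction i)
    case 0
    show ?case using \<open>w \<in> S\<close> by simp
  next
    case (Suc i)
    then have "(w ^ (n ^ i)) ^ n \<in> S" using image by blast
    then show ?case by (simp add: power_mult[symmetric] mult.commute)
  qed
  have "finite (range (\<lambda>i. w ^ (n ^ i)))"
    using orbit \<open>finite S\<close> by (auto intro: finite_subset)
  then have "\<not> inj (\<lambda>i::nat. w ^ (n ^ i))"
    using finite_imageD infinite_UNIV_nat by blast
  then obtain i j :: nat where ij: "i < j" "w ^ (n ^ i) = w ^ (n ^ j)"
    unfolding inj_def by (metis linorder_neqE_nat)
  have less: "n ^ i < n ^ j" using ij \<open>n > 1\<close> by simp
  then have "w ^ (n ^ i) * w ^ (n ^ j - n ^ i) = w ^ (n ^ i) * 1"
    using ij(2) less_imp_le[OF less] by (metis power_add le_add_diff_inverse mult_1_right)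
  moreover have "w ^ (n ^ i) \<noteq> 0" using orbit \<open>0 \<notin> S\<close> by metis
  ultimately have "w ^ (n ^ j - n ^ i) = 1" by (metis mult_cancel_left)
  with less show ?thesis by (intro exI[of _ "n ^ j - n ^ i"]) simp
qed

section \<open>Reduced fractions\<close>

lemma poly_denominator_eq_0_if_pole:
  assumes "is_pole (rat_eval f) w"
  shows "poly (snd (quot_of_fract f)) w = 0"
proof (rule ccontr)
  assume "poly (snd (quot_of_fract f)) w \<noteq> 0"
  then have "isCont (rat_eval f) w"
    unfolding rat_eval_def by (intro continuous_intros) auto
  then show False
    using assms not_tendsto_and_filterlim_at_infinity[of "at w"]
    by (auto simp: is_pole_def isCont_def)
qed

text \<open>
  If \<open>b\<close> vanished at \<open>0\<close>, then taking limits in \<open>f b = a\<close>, with \<open>f\<close> continuous at \<open>0\<close>, would make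
  \<open>a\<close> vanish there too, contradicting coprimality.
\<close>

lemma poly_denominator_0_nonzero:
  assumes "f \<in> rat_analytic_0"
  shows "poly (snd (quot_of_fract f)) 0 \<noteq> 0"
proof
  define a b where "a = fst (quot_of_fract f)" and "b = snd (quot_of_fract f)"
  have cop: "coprime a b" unfolding a_def b_def by (rule coprime_quot_of_fract)
  have "b \<noteq> 0" by (simp add: b_def)
  assume "poly (snd (quot_of_fract f)) 0 = 0"
  then have b0: "poly b 0 = 0" by (simp add: b_def)
  have a0: "poly a 0 \<noteq> 0"
  proof
    assume "poly a 0 = 0"
    with b0 cop have "is_unit [:-0, 1::complex:]"
      unfolding poly_eq_0_iff_dvd by (intro coprime_common_divisor)
    then show False by (simp add: is_unit_iff_degree)
  qed
  \<comment> \<open>The finitely many roots of \<open>b\<close> other than \<open>0\<close> form a closed set, so they stay away from \<open>0\<close>.\<close>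
  have "open (- {z. poly b z = 0} \<union> {0})"
    using finite_imp_closed[OF finite_subset[OF Diff_subset poly_roots_finite[OF \<open>b \<noteq> 0\<close>]], of "{0}"]
    by (simp add: closed_def Compl_Diff_eq)
  then have "eventually (\<lambda>z. poly b z \<noteq> 0) (at 0)"
    unfolding eventually_at_topological by blast
  then have "eventually (\<lambda>z. rat_eval f z * poly b z = poly a z) (at 0)"
    by eventually_elim (simp add: rat_eval_def a_def b_def)
  moreover have "isCont (rat_eval f) 0"
    using assms by (auto simp: rat_analytic_0_def intro: analytic_at_imp_isCont)
  then have "((\<lambda>z. rat_eval f z * poly b z) \<longlongrightarrow> rat_eval f 0 * poly b 0) (at 0)"
    by (intro tendsto_mult) (simp_all add: isContD poly_isCont)
  ultimately have "(poly a \<longlongrightarrow> rat_eval f 0 * poly b 0) (at 0)"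
    by (rule Lim_transform_eventually[rotated])
  moreover have "(poly a \<longlongrightarrow> poly a 0) (at 0)"
    by (simp add: isContD poly_isCont)
  ultimately have "poly a 0 = rat_eval f 0 * poly b 0"
    by (intro tendsto_unique[OF trivial_limit_at])
  with a0 b0 show False by simp
qed

lemma has_fps_expansion_fps_of_poly:
  fixes p :: "complex poly"
  shows "poly p has_fps_expansion fps_of_poly p"
proof (induction p)
  case 0
  show ?case by simp
next
  case (pCons c p)
  then have "(\<lambda>z. c + z * poly p z) has_fps_expansion fps_const c + fps_X * fps_of_poly p"
    by (intro fps_expansion_intros)
  then show ?case by (simp add: fps_of_poly_pCons add.commute mult.commute)
qed

lemma taylor_0_mult_denominator:
  assumes "f \<in> rat_analytic_0"
  shows "taylor_0 f * fps_of_poly (snd (quot_of_fract f)) = fps_of_poly (fst (quot_of_fract f))"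
proof -
  define a b where "a = fst (quot_of_fract f)" and "b = snd (quot_of_fract f)"
  have b0: "poly b 0 \<noteq> 0"
    using poly_denominator_0_nonzero[OF assms] by (simp add: b_def)
  have "rat_eval f has_fps_expansion taylor_0 f"
    using assms unfolding rat_analytic_0_def taylor_0_def
    by (auto intro: analytic_at_imp_has_fps_expansion_0)
  then have prod: "(\<lambda>z. rat_eval f z * poly b z) has_fps_expansion taylor_0 f * fps_of_poly b"
    by (intro has_fps_expansion_mult has_fps_expansion_fps_of_poly)
  have "open {z. poly b z \<noteq> 0}"
    by (intro open_Collect_neq continuous_intros)
  then have "eventually (\<lambda>z. poly b z \<noteq> 0) (nhds 0)"
    using b0 unfolding eventually_nhds by blast
  then have eq: "eventually (\<lambda>z. rat_eval f z * poly b z = poly a z) (nhds 0)"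
    by eventually_elim (simp add: rat_eval_def a_def b_def)
  have "poly a has_fps_expansion taylor_0 f * fps_of_poly b"
    by (rule iffD1[OF has_fps_expansion_cong[OF eq refl] prod])
  moreover have "poly a has_fps_expansion fps_of_poly a"
    by (rule has_fps_expansion_fps_of_poly)
  ultimately show ?thesis
    unfolding a_def b_def by (rule fps_expansion_unique_complex)
qed

section \<open>Eigenfunctions\<close>

theorem theorem1:
  fixes n :: nat and f :: "complex poly fract" and \<mu> :: complex
  assumes "n > 1"
    and "f \<in> rat_analytic_0" and "f \<noteq> 0"
    and "\<mu> \<noteq> 0"
    and "U_op n (taylor_0 f) = fps_const \<mu> * taylor_0 f"
  shows "\<forall>w. is_pole (rat_eval f) w \<longrightarrow> (\<exists>m>0. w ^ m = 1)"
proof (intro allI impI)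
  fix w assume pole: "is_pole (rat_eval f) w"
  define a b F S where "a = fst (quot_of_fract f)" and "b = snd (quot_of_fract f)"
    and "F = taylor_0 f" and "S = {z. poly b z = 0}"
  have n: "n > 0" using \<open>n > 1\<close> by simp
  have "b \<noteq> 0" by (simp add: b_def)
  have cop: "coprime b a"
    unfolding a_def b_def using coprime_quot_of_fract by (simp add: coprime_commute)
  have Fb: "F * fps_of_poly b = fps_of_poly a"
    unfolding F_def a_def b_def by (rule taylor_0_mult_denominator[OF assms(2)])
  obtain Q where "b dvd pcompose Q (monom 1 n)"
    and Q_roots: "\<And>z. poly Q z = 0 \<Longrightarrow> \<exists>v. poly b v = 0 \<and> z = v ^ n"
    using dvd_pcompose_monom_power_roots[OF \<open>b \<noteq> 0\<close>] by blast
  then obtain h where h: "pcompose Q (monom 1 n) = b * h" by (elim dvdE)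
  obtain s where s: "U_op n (fps_of_poly (a * h)) = fps_of_poly s"
    using U_op_fps_of_poly[OF n] by blast
  have "F * fps_of_poly (pcompose Q (monom 1 n)) = fps_of_poly (a * h)"
    by (simp add: h fps_of_poly_mult mult.assoc[symmetric] Fb)
  then have "fps_of_poly s = fps_const \<mu> * F * fps_of_poly Q"
    using U_op_mult_pcompose_monom[OF n, of F Q] assms(5) s by (simp add: F_def)
  then have "fps_of_poly (s * b) = fps_of_poly (smult \<mu> (a * Q))"
    using Fb by (simp add: fps_of_poly_mult fps_of_poly_smult mult_ac)
  then have "s * b = smult \<mu> (a * Q)"
    by (simp only: fps_of_poly_eq_iff)
  then have "b dvd smult \<mu> (a * Q)" by (metis dvd_triv_right)
  then have "b dvd a * Q" using \<open>\<mu> \<noteq> 0\<close> by (simp add: dvd_smult_iff)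
  then have "b dvd Q" using cop by (simp add: coprime_dvd_mult_right_iff)
  then have "S \<subseteq> (\<lambda>v. v ^ n) ` S"
    using Q_roots unfolding S_def by (fastforce elim!: dvdE)
  moreover have "finite S"
    unfolding S_def using \<open>b \<noteq> 0\<close> by (rule poly_roots_finite)
  moreover have "0 \<notin> S"
    using poly_denominator_0_nonzero[OF assms(2)] by (simp add: S_def b_def)
  moreover have "w \<in> S"
    using poly_denominator_eq_0_if_pole[OF pole] by (simp add: S_def b_def)
  ultimately show "\<exists>m>0. w ^ m = 1"
    using root_of_unity_if_subset_powers \<open>n > 1\<close> by blast
qed

end
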